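(* For any graph $G$ with $\Delta(G)-\delta(G)\le2$, $\mathrm{def}_c(G)\le|V(G)|$.
   Context: All graphs are finite, simple and undirected; $\Delta(G)$ and $\delta(G)$ denote the maximum and minimum degree. A set $A\subseteq\{1,\dots,t\}$ is a cyclic interval modulo $t$ if $A$ or $\{1,\dots,t\}\setminus A$ is an interval of integers; a cyclic interval $t$-coloring is a proper edge coloring with colors $1,\dots,t$ in which the set of colors at every vertex is a cyclic interval modulo $t$. The cyclic deficiency $\mathrm{def}_c(G)$ is the minimum number of pendant edges whose attachment to $G$ yields a graph admitting a cyclic interval coloring; equivalently, it is the minimum over proper edge colorings $\alpha$ of $G$ with colors $1,\dots,t$ (any $t$) of $\sum_v$ (the minimum number of positive integers whose addition to the set of colors at $v$ makes it a cyclic interval modulo $t$). *)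

theory Defs imports Main begin

definition simple_graph :: "'a set \<Rightarrow> 'a set set \<Rightarrow> bool" where
  "simple_graph V E \<longleftrightarrow> finite V \<and> (\<forall>e\<in>E. e \<subseteq> V \<and> card e = 2)"

definition incident_edges :: "'a set set \<Rightarrow> 'a \<Rightarrow> 'a set set" where
  "incident_edges E v = {e \<in> E. v \<in> e}"

definition degree :: "'a set set \<Rightarrow> 'a \<Rightarrow> nat" where
  "degree E v = card (incident_edges E v)"

definition max_degree :: "'a set \<Rightarrow> 'a set set \<Rightarrow> nat" where
  "max_degree V E = Max (degree E ` V)"

definition min_degree :: "'a set \<Rightarrow> 'a set set \<Rightarrow> nat" where
  "min_degree V E = Min (degree E ` V)"

definition proper_edge_coloring :: "'a set set \<Rightarrow> nat \<Rightarrow> ('a set \<Rightarrow> nat) \<Rightarrow> bool" where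
  "proper_edge_coloring E t \<alpha> \<longleftrightarrow>
     \<alpha> ` E \<subseteq> {1..t} \<and>
     (\<forall>e\<in>E. \<forall>f\<in>E. e \<noteq> f \<and> e \<inter> f \<noteq> {} \<longrightarrow> \<alpha> e \<noteq> \<alpha> f)"

definition color_set :: "'a set set \<Rightarrow> ('a set \<Rightarrow> nat) \<Rightarrow> 'a \<Rightarrow> nat set" where
  "color_set E \<alpha> v = \<alpha> ` incident_edges E v"

text \<open>The empty set counts as an interval (take \<open>b < a\<close>), so isolated vertices impose no condition.\<close>

definition integer_interval :: "nat set \<Rightarrow> bool" where
  "integer_interval A \<longleftrightarrow> (\<exists>a b. A = {a..b})"

definition cyclic_interval :: "nat \<Rightarrow> nat set \<Rightarrow> bool" where
  "cyclic_interval t A \<longleftrightarrow>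
     A \<subseteq> {1..t} \<and> (integer_interval A \<or> integer_interval ({1..t} - A))"

definition cyclic_interval_coloring ::
    "'a set \<Rightarrow> 'a set set \<Rightarrow> nat \<Rightarrow> ('a set \<Rightarrow> nat) \<Rightarrow> bool" where
  "cyclic_interval_coloring V E t \<alpha> \<longleftrightarrow>
     proper_edge_coloring E t \<alpha> \<and> (\<forall>v\<in>V. cyclic_interval t (color_set E \<alpha> v))"

definition cyclically_interval_colorable :: "'a set \<Rightarrow> 'a set set \<Rightarrow> bool" where
  "cyclically_interval_colorable V E \<longleftrightarrow> (\<exists>t \<alpha>. cyclic_interval_coloring V E t \<alpha>)"

text \<open>Attaching \<open>m v\<close> pendant edges at every vertex \<open>v\<close> of the graph. The old vertices are
  \<open>Inl v\<close>; the new leaves at \<open>v\<close> are \<open>Inr (v, i)\<close> with \<open>i < m v\<close>. The sum type provides fresh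
  vertices even if the vertex type of the original graph is finite.\<close>

definition pendant_verts :: "'a set \<Rightarrow> ('a \<Rightarrow> nat) \<Rightarrow> ('a + 'a \<times> nat) set" where
  "pendant_verts V m = Inl ` V \<union> Inr ` (SIGMA v:V. {..<m v})"

definition pendant_edges :: "'a set \<Rightarrow> 'a set set \<Rightarrow> ('a \<Rightarrow> nat) \<Rightarrow> ('a + 'a \<times> nat) set set" where
  "pendant_edges V E m =
     (\<lambda>e. Inl ` e) ` E \<union> {{Inl v, Inr (v, i)} | v i. v \<in> V \<and> i < m v}"

text \<open>For a finite simple graph the minimum exists: color the edges injectively with
  \<open>1, \<dots>, card E\<close> and attach one pendant edge per missing color at every vertex.\<close>

definition cyclic_deficiency :: "'a set \<Rightarrow> 'a set set \<Rightarrow> nat" where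
  "cyclic_deficiency V E =
     (LEAST k. \<exists>m. k = (\<Sum>v\<in>V. m v) \<and>
        cyclically_interval_colorable (pendant_verts V m) (pendant_edges V E m))"

end

theory Submission imports Defs "HOL-Combinatorics.Transposition" begin

text \<open>Let \<open>D\<close> be the maximum degree and \<open>A\<close>, \<open>B\<close>, \<open>C\<close> the sets of vertices of degree \<open>D\<close>, \<open>D - 1\<close>,
  \<open>D - 2\<close>. In a proper coloring with \<open>D + 1\<close> colors a vertex of \<open>A\<close>, \<open>B\<close>, \<open>C\<close> costs at most 0, 1, 2
  pendant edges, and a vertex of \<open>C\<close> which misses both cyclically adjacent colors \<open>D\<close>, \<open>D + 1\<close>
  costs only 1. So it suffices that at most \<open>|A|\<close> vertices of \<open>C\<close> see one of these two colors.

  The edges of colors \<open>D\<close>, \<open>D + 1\<close> form a maximal subgraph \<open>F\<close> that covers \<open>A\<close>, is a union of two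
  matchings, and in which every vertex of \<open>A\<close> has at most one neighbour in \<open>C\<close> while the edges at
  \<open>C\<close> come from \<open>A\<close>. By maximality and a Kempe change, in \<open>G - F\<close> the vertices of degree \<open>D - 1\<close>
  induce a matching at most, and then \<open>G - F\<close> is \<open>(D - 1)\<close>-edge-colorable by the theorem of Vizing
  and Fournier.\<close>

section \<open>Kempe changes\<close>

text \<open>Unlike in \<open>proper_edge_coloring\<close>, the palette is an arbitrary set: the
  induction for stars deletes single colors, and \<open>F\<close> uses only \<open>D\<close> and
  \<open>D + 1\<close>.\<close>

definition edge_col :: "'a set set \<Rightarrow> nat set \<Rightarrow> ('a set \<Rightarrow> nat) \<Rightarrow> bool" where
  "edge_col E C \<alpha> \<longleftrightarrow>
     \<alpha> ` E \<subseteq> C \<and> (\<forall>e\<in>E. \<forall>f\<in>E. e \<noteq> f \<and> e \<inter> f \<noteq> {} \<longrightarrow> \<alpha> e \<noteq> \<alpha> f)"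

text \<open>Such a \<open>W\<close> is a union of components of the subgraph formed by the colors
  \<open>i\<close> and \<open>j\<close>. Working with closed sets avoids any handling of alternating
  paths.\<close>

definition kempe_closed :: "'a set set \<Rightarrow> ('a set \<Rightarrow> nat) \<Rightarrow> nat \<Rightarrow> nat \<Rightarrow> 'a set \<Rightarrow> bool" where
  "kempe_closed E \<alpha> i j W \<longleftrightarrow> (\<forall>e\<in>E. \<alpha> e \<in> {i, j} \<and> e \<inter> W \<noteq> {} \<longrightarrow> e \<subseteq> W)"

text \<open>The open slots of \<open>S\<close>: edges leaving \<open>S\<close> do not count, so that
  \<open>S\<close> can be grown along them. On a closed set the slots are the vertices missing the
  color in the whole graph.\<close>

definition lacking :: "'a set set \<Rightarrow> ('a set \<Rightarrow> nat) \<Rightarrow> nat \<Rightarrow> 'a set \<Rightarrow> 'a set" where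
  "lacking E \<alpha> c S = {x \<in> S. \<not> (\<exists>e\<in>E. \<alpha> e = c \<and> x \<in> e \<and> e \<subseteq> S)}"

lemma edge_colD: "edge_col E C \<alpha> \<Longrightarrow> e \<in> E \<Longrightarrow> f \<in> E \<Longrightarrow> x \<in> e \<Longrightarrow> x \<in> f \<Longrightarrow> \<alpha> e = \<alpha> f \<Longrightarrow> e = f"
  unfolding edge_col_def by blast

lemma edge_col_mem: "edge_col E C \<alpha> \<Longrightarrow> e \<in> E \<Longrightarrow> \<alpha> e \<in> C"
  unfolding edge_col_def by blast

lemma color_set_iff: "c \<in> color_set E \<alpha> x \<longleftrightarrow> (\<exists>e\<in>E. x \<in> e \<and> \<alpha> e = c)"
  unfolding color_set_def incident_edges_def by auto

lemma lacking_closed: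
  assumes "kempe_closed E \<alpha> i j W" "c \<in> {i, j}"
  shows "lacking E \<alpha> c W = {x \<in> W. c \<notin> color_set E \<alpha> x}"
  using assms unfolding lacking_def kempe_closed_def color_set_iff by blast

text \<open>A union of two matchings has maximum degree 2, so growing a connected set along its edges
  never increases the number of open slots, which is 2 for a single vertex.\<close>

lemma lacking_grow:
  assumes col: "edge_col E C \<alpha>" and e: "{x, y} \<in> E" "\<alpha> {x, y} = i" "x \<in> S" "y \<notin> S"
    and fin: "finite S"
  shows "card (lacking E \<alpha> i (insert y S)) + card (lacking E \<alpha> j (insert y S))
       \<le> card (lacking E \<alpha> i S) + card (lacking E \<alpha> j S)"
proof -
  have x: "x \<in> lacking E \<alpha> i S"
    using e edge_colD[OF col e(1)] unfolding lacking_def by blast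
  have 1: "lacking E \<alpha> i (insert y S) \<subseteq> lacking E \<alpha> i S - {x}"
    using e unfolding lacking_def by blast
  have 2: "lacking E \<alpha> j (insert y S) \<subseteq> insert y (lacking E \<alpha> j S)"
    unfolding lacking_def by blast
  have f: "finite (lacking E \<alpha> c S)" for c using fin unfolding lacking_def by simp
  have "card (lacking E \<alpha> i (insert y S)) \<le> card (lacking E \<alpha> i S) - 1"
    using card_mono[OF _ 1] f x by (simp add: card_Diff_singleton)
  moreover have "card (lacking E \<alpha> j (insert y S)) \<le> card (lacking E \<alpha> j S) + 1"
    using card_mono[OF _ 2] f card_insert_le_m1 by (metis Suc_eq_plus1 card_insert_if finite_insert le_SucI le_refl order_trans)
  moreover have "card (lacking E \<alpha> i S) > 0" using x f card_gt_0_iff by blast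
  ultimately show ?thesis by linarith
qed

text \<open>This replaces the fact that a component of a union of two matchings is a path or a
  cycle. Among the subsets of \<open>Z\<close> that contain \<open>x\<close> and have at most two
  open slots, a largest one is closed: otherwise an edge leaving it would allow growth by
  \<open>lacking_grow\<close>.\<close>

lemma kempe_component:
  assumes col: "edge_col E C \<alpha>" and two: "\<forall>e\<in>E. card e = 2"
    and Z: "finite Z" "kempe_closed E \<alpha> i j Z" "x \<in> Z"
  obtains W where "W \<subseteq> Z" "x \<in> W" "kempe_closed E \<alpha> i j W"
    "card {y \<in> W. i \<notin> color_set E \<alpha> y} + card {y \<in> W. j \<notin> color_set E \<alpha> y} \<le> 2"
proof -
  let ?P = "\<lambda>S. S \<subseteq> Z \<and> x \<in> S \<and> card (lacking E \<alpha> i S) + card (lacking E \<alpha> j S) \<le> 2"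
  have "lacking E \<alpha> c {x} \<subseteq> {x}" for c unfolding lacking_def by blast
  then have "card (lacking E \<alpha> c {x}) \<le> 1" for c
    using card_mono[of "{x}" "lacking E \<alpha> c {x}"] by simp
  from this[of i] this[of j] have P0: "?P {x}" using Z(3) by auto
  have "\<exists>W. ?P W \<and> (\<forall>S. ?P S \<longrightarrow> card S \<le> card W)"
    by (rule ex_has_greatest_nat[where b = "Suc (card Z)" and k = "{x}"])
      (use P0 Z(1) in \<open>auto simp: less_Suc_eq_le intro: card_mono\<close>)
  then obtain W where W: "?P W" and max: "\<And>S. ?P S \<Longrightarrow> card S \<le> card W" by blast
  have finW: "finite W" using W Z(1) finite_subset by blast
  have "kempe_closed E \<alpha> i j W"
  proof (rule ccontr)
    assume "\<not> ?thesis"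
    then obtain e where e: "e \<in> E" "\<alpha> e \<in> {i, j}" "e \<inter> W \<noteq> {}" "\<not> e \<subseteq> W"
      unfolding kempe_closed_def by blast
    then obtain a b where ab: "a \<in> e" "a \<in> W" "b \<in> e" "b \<notin> W" by blast
    then have e': "e = {a, b}" using two e(1) by (metis card_2_iff doubleton_eq_iff insertE singletonD)
    have "e \<subseteq> Z" using Z(2) e ab W unfolding kempe_closed_def by blast
    moreover have "card (lacking E \<alpha> i (insert b W)) + card (lacking E \<alpha> j (insert b W)) \<le> 2"
      using lacking_grow[OF col, of a b i W j] lacking_grow[OF col, of a b j W i] e e' ab W finW by auto
    ultimately have "?P (insert b W)" using W ab by blast
    from max[OF this] show False using finW ab by simp
  qed
  then show ?thesis using that[of W] W lacking_closed[of E \<alpha> i j W] by auto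
qed

definition kempe_swap :: "nat \<Rightarrow> nat \<Rightarrow> 'a set \<Rightarrow> ('a set \<Rightarrow> nat) \<Rightarrow> 'a set \<Rightarrow> nat" where
  "kempe_swap i j W \<alpha> e = (if e \<subseteq> W then transpose i j (\<alpha> e) else \<alpha> e)"

text \<open>The critical case is an edge inside \<open>W\<close> that meets an edge not inside
  \<open>W\<close>. Closedness keeps the colors \<open>i\<close> and \<open>j\<close> off the second
  edge, and the transposition moves no color onto any other one.\<close>

lemma edge_col_kempe_swap:
  assumes col: "edge_col E C \<alpha>" and W: "kempe_closed E \<alpha> i j W" and ij: "i \<in> C" "j \<in> C"
  shows "edge_col E C (kempe_swap i j W \<alpha>)"
  unfolding edge_col_def
proof (intro conjI ballI impI)
  show "kempe_swap i j W \<alpha> ` E \<subseteq> C"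
    using edge_col_mem[OF col] ij by (auto simp: kempe_swap_def transpose_def)
  have mixed: "transpose i j (\<alpha> e) \<noteq> \<alpha> f"
    if "e \<in> E" "f \<in> E" "e \<inter> f \<noteq> {}" "\<alpha> e \<noteq> \<alpha> f" "e \<subseteq> W" "\<not> f \<subseteq> W" for e f
  proof
    assume eq: "transpose i j (\<alpha> e) = \<alpha> f"
    have "\<alpha> f \<notin> {i, j}" using that W unfolding kempe_closed_def by blast
    then have "\<alpha> e \<notin> {i, j}" using eq by (auto simp: transpose_def split: if_splits)
    then show False using eq that(4) by (simp add: transpose_def)
  qed
  fix e f assume ef: "e \<in> E" "f \<in> E" "e \<noteq> f \<and> e \<inter> f \<noteq> {}"
  then have ne: "\<alpha> e \<noteq> \<alpha> f" using col unfolding edge_col_def by blast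
  show "kempe_swap i j W \<alpha> e \<noteq> kempe_swap i j W \<alpha> f"
    using mixed[of e f] mixed[of f e] ef ne
    by (cases "e \<subseteq> W"; cases "f \<subseteq> W") (simp_all add: kempe_swap_def Int_commute inj_eq[OF inj_transpose])
qed

text \<open>An edge of color \<open>i\<close> or \<open>j\<close> at \<open>x\<close> lies inside
  the closed set \<open>W\<close> exactly when \<open>x\<close> does, and the transposition fixes
  every other color.\<close>

lemma color_set_kempe_swap:
  assumes two: "\<forall>e\<in>E. card e = 2" and W: "kempe_closed E \<alpha> i j W"
  shows "color_set E (kempe_swap i j W \<alpha>) x =
    (if x \<in> W then transpose i j ` color_set E \<alpha> x else color_set E \<alpha> x)"
proof -
  have "kempe_swap i j W \<alpha> e = (if x \<in> W then transpose i j (\<alpha> e) else \<alpha> e)"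
    if "e \<in> incident_edges E x" for e
    using that W unfolding kempe_swap_def kempe_closed_def incident_edges_def
    by (auto simp: transpose_def)
  then show ?thesis unfolding color_set_def by (auto simp: image_image cong: image_cong)
qed


section \<open>Extending a coloring by a star\<close>

text \<open>The tokens of a vertex are chosen colors missing there, candidates for a new edge at it.
  A closed set on which color \<open>i\<close> has more tokens than color \<open>j\<close> contains a closed set on
  which the surplus is 1 or 2: pass to a component or to its complement.\<close>

lemma kempe_surplus:
  assumes col: "edge_col E C \<alpha>" and two: "\<forall>e\<in>E. card e = 2"
    and I: "\<forall>x\<in>I. i \<notin> color_set E \<alpha> x"
    and Z: "finite Z" "kempe_closed E \<alpha> i j Z" "card (J \<inter> Z) < card (I \<inter> Z)"
  shows "\<exists>W. kempe_closed E \<alpha> i j W \<and> card (J \<inter> W) < card (I \<inter> W) \<and> card (I \<inter> W) \<le> 2"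
  using Z
proof (induction "card Z" arbitrary: Z rule: less_induct)
  case less
  then obtain x where x: "x \<in> I" "x \<in> Z"
    by (metis card_gt_0_iff disjoint_iff gr_zeroI less_nat_zero_code)
  obtain W where W: "W \<subseteq> Z" "x \<in> W" "kempe_closed E \<alpha> i j W"
    and c: "card {y \<in> W. i \<notin> color_set E \<alpha> y} + card {y \<in> W. j \<notin> color_set E \<alpha> y} \<le> 2"
    by (rule kempe_component[OF col two less.prems(1,2) x(2)])
  have finW: "finite W" using W less.prems(1) finite_subset by blast
  \<comment> \<open>Tokens of color \<open>i\<close> sit only at vertices missing \<open>i\<close>,
    so the bound for the component limits them.\<close>
  have "card (I \<inter> W) \<le> card {y \<in> W. i \<notin> color_set E \<alpha> y}"
    by (rule card_mono) (use finW I in auto)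
  with c have le2: "card (I \<inter> W) \<le> 2" by linarith
  show ?case
  proof (cases "card (J \<inter> W) < card (I \<inter> W)")
    case True
    with W le2 show ?thesis by blast
  next
    case False
    \<comment> \<open>Counts add over \<open>W\<close> and \<open>Z - W\<close>. As \<open>W\<close>
      has no surplus, the smaller closed set \<open>Z - W\<close> inherits it.\<close>
    have split: "card (S \<inter> Z) = card (S \<inter> W) + card (S \<inter> (Z - W))" for S
    proof -
      have "S \<inter> Z = (S \<inter> W) \<union> (S \<inter> (Z - W))" using W(1) by blast
      then show ?thesis using card_Un_disjoint[of "S \<inter> W" "S \<inter> (Z - W)"] finW less.prems(1) by auto
    qed
    have "kempe_closed E \<alpha> i j (Z - W)"
      using less.prems(2) W(3) unfolding kempe_closed_def by blast
    moreover have "card (J \<inter> (Z - W)) < card (I \<inter> (Z - W))"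
      using split[of I] split[of J] False less.prems(3) by linarith
    moreover have "card (Z - W) < card Z"
      using W less.prems(1) by (intro psubset_card_mono) auto
    ultimately show ?thesis using less.hyps[of "Z - W"] less.prems(1) by blast
  qed
qed

lemma card_exchange:
  assumes "finite I" "finite J"
  shows "card ((I - W) \<union> (J \<inter> W)) = card I + card (J \<inter> W) - card (I \<inter> W)"
proof -
  have "card ((I - W) \<union> (J \<inter> W)) = card (I - W) + card (J \<inter> W)"
    using assms by (intro card_Un_disjoint) auto
  moreover have "card (I - W) = card I - card (I \<inter> W)"
    using assms by (simp add: card_Diff_subset_Int)
  moreover have "card (I \<inter> W) \<le> card I" using assms by (simp add: card_mono)
  ultimately show ?thesis by linarith
qed

text \<open>Take the coloring and tokens that minimize the sum of the squared numbers of tokens per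
  color. If color \<open>i\<close> had at least three tokens more than \<open>j\<close>, a Kempe
  change on a set with surplus 1 or 2 would move that surplus from \<open>i\<close> to
  \<open>j\<close> and decrease the sum.\<close>

lemma balanced_tokens:
  fixes T :: "'a \<Rightarrow> nat set"
  assumes fin: "finite C" "finite E" "finite N" and two: "\<forall>e\<in>E. card e = 2"
    and col: "edge_col E C \<alpha>"
    and T: "\<forall>u\<in>N. T u \<subseteq> C - color_set E \<alpha> u"
  obtains \<beta> S where "edge_col E C \<beta>"
    "\<forall>u\<in>N. S u \<subseteq> C - color_set E \<beta> u \<and> card (S u) = card (T u)"
    "\<forall>i\<in>C. \<forall>j\<in>C. card {u\<in>N. i \<in> S u} \<le> card {u\<in>N. j \<in> S u} + 2"
proof -
  define P where "P = (\<lambda>(\<beta>, S :: 'a \<Rightarrow> nat set). edge_col E C \<beta> \<and>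
    (\<forall>u\<in>N. S u \<subseteq> C - color_set E \<beta> u \<and> card (S u) = card (T u)))"
  define X where "X = (\<lambda>(S :: 'a \<Rightarrow> nat set) c. {u\<in>N. c \<in> S u})"
  define m where "m = (\<lambda>(\<beta> :: 'a set \<Rightarrow> nat, S). \<Sum>c\<in>C. (card (X S c))\<^sup>2)"
  have "P (\<alpha>, T)" using col T unfolding P_def by auto
  from ex_has_least_nat[of P, OF this, of m]
  obtain \<beta> S where PS: "P (\<beta>, S)" and min: "\<And>\<beta>' S'. P (\<beta>', S') \<Longrightarrow> m (\<beta>, S) \<le> m (\<beta>', S')"
    by auto
  have col': "edge_col E C \<beta>" and S: "\<forall>u\<in>N. S u \<subseteq> C - color_set E \<beta> u \<and> card (S u) = card (T u)"
    using PS unfolding P_def by auto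
  have finX: "finite (X S c)" for c using fin unfolding X_def by auto
  have "card (X S i) \<le> card (X S j) + 2" if ij: "i \<in> C" "j \<in> C" for i j
  proof (rule ccontr)
    assume "\<not> ?thesis"
    then have gt: "card (X S i) \<ge> card (X S j) + 3" by linarith
    then have ne: "i \<noteq> j" by auto
    \<comment> \<open>A finite set containing all edges and all token vertices: it is trivially
      closed and carries the full surplus.\<close>
    let ?Z = "N \<union> \<Union>E"
    have "finite e" if "e \<in> E" for e using two that by (metis card.infinite zero_neq_numeral)
    then have finZ: "finite ?Z" using fin by blast
    have "kempe_closed E \<beta> i j ?Z" unfolding kempe_closed_def by blast
    moreover have "X S c \<inter> ?Z = X S c" for c unfolding X_def by blast
    moreover have "\<forall>x\<in>X S i. i \<notin> color_set E \<beta> x" using S unfolding X_def by blast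
    ultimately obtain W where W: "kempe_closed E \<beta> i j W"
      "card (X S j \<inter> W) < card (X S i \<inter> W)" "card (X S i \<inter> W) \<le> 2"
      using kempe_surplus[OF col' two _ finZ, of "X S i" i j "X S j"] gt by auto
    let ?\<beta> = "kempe_swap i j W \<beta>"
    \<comment> \<open>Tokens are transposed together with the colors, so they remain missing colors
      and keep their number at each vertex.\<close>
    define S' where "S' = (\<lambda>u. if u \<in> W then transpose i j ` S u else S u)"
    have "P (?\<beta>, S')"
      unfolding P_def
    proof (clarsimp, intro conjI ballI)
      show "edge_col E C ?\<beta>" by (rule edge_col_kempe_swap[OF col' W(1) ij])
      fix u assume u: "u \<in> N"
      have "transpose i j ` (C - color_set E \<beta> u) = C - transpose i j ` color_set E \<beta> u"
        using ij by (simp add: image_set_diff)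
      then show "S' u \<subseteq> C - color_set E ?\<beta> u"
        using S u unfolding S'_def color_set_kempe_swap[OF two W(1)] by auto
      show "card (S' u) = card (T u)"
        using S u unfolding S'_def by (auto simp: card_image)
    qed
    from min[OF this] have le: "m (\<beta>, S) \<le> m (?\<beta>, S')" .
    have mem: "c \<in> S' u \<longleftrightarrow> (if u \<in> W then transpose i j c \<in> S u else c \<in> S u)" for c u
      unfolding S'_def by (auto simp: image_iff intro: bexI[of _ "transpose i j c"])
    have Xi: "X S' i = (X S i - W) \<union> (X S j \<inter> W)" and Xj: "X S' j = (X S j - W) \<union> (X S i \<inter> W)"
      unfolding X_def mem by (auto split: if_splits)
    have Xc: "X S' c = X S c" if "c \<notin> {i, j}" for c
      using that unfolding X_def mem by (auto split: if_splits)
    define p q d where "p = card (X S i)" and "q = card (X S j)"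
      and "d = card (X S i \<inter> W) - card (X S j \<inter> W)"
    have d: "d = 1 \<or> d = 2" using W unfolding d_def by linarith
    have pi: "card (X S' i) = p - d"
      unfolding Xi card_exchange[OF finX finX] p_def d_def using W(2) by linarith
    have qj: "card (X S' j) = q + d"
      unfolding Xj card_exchange[OF finX finX] q_def d_def using W(2) by linarith
    obtain s where s: "p = q + 3 + s" using gt unfolding p_def q_def using le_Suc_ex by blast
    \<comment> \<open>The sum of the two squares changes by \<open>- 2 * d * (p - q - d)\<close>,
      which is negative since \<open>p - q\<close> is at least 3 and \<open>d\<close> at most
      2.\<close>
    have sq: "(p - d)\<^sup>2 + (q + d)\<^sup>2 < p\<^sup>2 + q\<^sup>2"
      using d unfolding s by (elim disjE) (simp_all add: power2_eq_square algebra_simps)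
    have decomp: "(\<Sum>c\<in>C. f c) = f i + f j + (\<Sum>c\<in>C - {i, j}. f c)" for f :: "nat \<Rightarrow> nat"
    proof -
      have "(\<Sum>c\<in>C. f c) = f i + (\<Sum>c\<in>C - {i}. f c)" using fin ij by (simp add: sum.remove)
      also have "(\<Sum>c\<in>C - {i}. f c) = f j + (\<Sum>c\<in>C - {i} - {j}. f c)"
        using fin ij ne by (intro sum.remove) auto
      also have "C - {i} - {j} = C - {i, j}" by blast
      finally show ?thesis by simp
    qed
    have "m (?\<beta>, S') = (p - d)\<^sup>2 + (q + d)\<^sup>2 + (\<Sum>c\<in>C - {i, j}. (card (X S c))\<^sup>2)"
      unfolding m_def prod.case decomp pi qj using Xc by simp
    moreover have "m (\<beta>, S) = p\<^sup>2 + q\<^sup>2 + (\<Sum>c\<in>C - {i, j}. (card (X S c))\<^sup>2)"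
      unfolding m_def prod.case decomp p_def q_def by simp
    ultimately show False using le sq by linarith
  qed
  then show ?thesis using that[OF col' S] unfolding X_def by blast
qed

text \<open>Schrijver's proof of the Vizing-Fournier theorem: in a balanced choice of tokens some color
  occurs exactly once, at \<open>u\<close> say; give this color to the edge \<open>{v, u}\<close> and delete its class.\<close>

lemma extend_coloring:
  fixes v w :: 'a and T :: "'a \<Rightarrow> nat set"
  assumes "finite C" "finite E" "finite N" "\<forall>e\<in>E. card e = 2"
    and "edge_col E C \<alpha>" "v \<notin> \<Union>E" "v \<notin> N" "card N \<le> card C"
    and "\<forall>u\<in>N. T u \<subseteq> C - color_set E \<alpha> u"
    and "\<forall>u\<in>N. (if u = w then 1 else 2) \<le> card (T u)"
  shows "\<exists>\<beta>. edge_col (E \<union> (\<lambda>u. {v, u}) ` N) C \<beta>"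
  using assms
proof (induction "card N" arbitrary: N C E \<alpha> T w)
  case 0
  then show ?case by auto
next
  case (Suc n)
  \<comment> \<open>The exceptional vertex \<open>w\<close> may lie outside \<open>N\<close>;
    \<open>w'\<close> lies in \<open>N\<close> and equals \<open>w\<close> whenever \<open>w\<close>
    does. Trimming to one token at \<open>w'\<close> and two at every other vertex makes the total
    odd.\<close>
  obtain w' where w': "w' \<in> N" "w \<in> N \<Longrightarrow> w' = w"
    using Suc.hyps(2) by (metis card.empty ex_in_conv nat.distinct(1))
  define r :: "'a \<Rightarrow> nat" where "r u = (if u = w' then 1 else 2)" for u
  have "\<forall>u\<in>N. \<exists>S. S \<subseteq> T u \<and> card S = r u"
  proof
    fix u assume u: "u \<in> N"
    then have "r u \<le> card (T u)" using bspec[OF Suc.prems(10) u] w'(2) u unfolding r_def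
      by (cases "u = w"; cases "u = w'") auto
    then show "\<exists>S. S \<subseteq> T u \<and> card S = r u" by (meson obtain_subset_with_card_n)
  qed
  then obtain T0 where T0: "\<forall>u\<in>N. T0 u \<subseteq> T u \<and> card (T0 u) = r u" by metis
  then have "\<forall>u\<in>N. T0 u \<subseteq> C - color_set E \<alpha> u" using Suc.prems(9) by blast
  then obtain \<beta> S where \<beta>: "edge_col E C \<beta>"
    and S': "\<forall>u\<in>N. S u \<subseteq> C - color_set E \<beta> u \<and> card (S u) = card (T0 u)"
    and bal: "\<forall>i\<in>C. \<forall>j\<in>C. card {u\<in>N. i \<in> S u} \<le> card {u\<in>N. j \<in> S u} + 2"
    by (rule balanced_tokens[OF Suc.prems(1-5)])
  have S: "S u \<subseteq> C - color_set E \<beta> u" "card (S u) = r u" if "u \<in> N" for u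
    using that S' T0 by auto
  define x where "x c = card {u\<in>N. c \<in> S u}" for c
  have "(\<Sum>c\<in>C. x c) = (\<Sum>c\<in>C. \<Sum>u\<in>N. of_bool (c \<in> S u))"
    unfolding x_def using Suc.prems(3) by (simp add: Int_def)
  also have "\<dots> = (\<Sum>u\<in>N. \<Sum>c\<in>C. of_bool (c \<in> S u))" by (rule sum.swap)
  also have "\<dots> = (\<Sum>u\<in>N. r u)"
  proof (rule sum.cong[OF refl])
    fix u assume u: "u \<in> N"
    then have "C \<inter> {c. c \<in> S u} = S u" using S(1) by blast
    then show "(\<Sum>c\<in>C. of_bool (c \<in> S u)) = r u" using S(2)[OF u] Suc.prems(1) by simp
  qed
  also have "\<dots> = r w' + (\<Sum>u\<in>N - {w'}. r u)" using w' Suc.prems(3) by (simp add: sum.remove)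
  also have "(\<Sum>u\<in>N - {w'}. r u) = 2 * n"
    using w' Suc.prems(3) Suc.hyps(2) by (simp add: r_def)
  finally have sum: "(\<Sum>c\<in>C. x c) = Suc (2 * n)" by (simp add: r_def)
  \<comment> \<open>Suppose no count is 1. The total \<open>2 * n + 1\<close> is below twice the
    number of colors, so some count is 0; balance then bounds all counts by 2, so all are 0 or 2,
    against the odd total.\<close>
  have "\<exists>c\<in>C. x c = 1"
  proof (rule ccontr)
    assume no1: "\<not> ?thesis"
    have "\<exists>j\<in>C. x j = 0"
    proof (rule ccontr)
      assume "\<not> ?thesis"
      then have "\<forall>c\<in>C. 2 \<le> x c" using no1 by (metis less_2_cases not_less One_nat_def)
      then have "(\<Sum>c\<in>C. 2) \<le> (\<Sum>c\<in>C. x c)" by (intro sum_mono) auto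
      then show False using sum Suc.hyps(2) Suc.prems(8) by simp
    qed
    then have "\<forall>c\<in>C. x c \<le> 2" using bal unfolding x_def by fastforce
    then have "x c = 0 \<or> x c = 2" if "c \<in> C" for c
      using that no1 by (metis One_nat_def le_neq_implies_less less_2_cases)
    then have "\<forall>c\<in>C. even (x c)" by fastforce
    then have "even (\<Sum>c\<in>C. x c)" by (simp add: dvd_sum)
    then show False using sum by simp
  qed
  then obtain c u where c: "c \<in> C" and "{u\<in>N. c \<in> S u} = {u}"
    unfolding x_def by (auto simp: card_1_singleton_iff)
  then have u: "u \<in> N" "c \<in> S u" and uniq: "\<And>z. z \<in> N \<Longrightarrow> c \<in> S z \<Longrightarrow> z = u" by blast+
  \<comment> \<open>No vertex other than \<open>u\<close> has \<open>c\<close> as a token, so all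
    remaining tokens survive the deletion of \<open>c\<close>, and \<open>w'\<close> serves as the
    new exceptional vertex.\<close>
  let ?E = "{e \<in> E. \<beta> e \<noteq> c}" and ?C = "C - {c}" and ?N = "N - {u}"
  have "\<exists>\<gamma>. edge_col (?E \<union> (\<lambda>u. {v, u}) ` ?N) ?C \<gamma>"
  proof (rule Suc.hyps(1))
    show "n = card ?N" using Suc.hyps(2) u Suc.prems(3) by simp
    show "finite ?C" "finite ?E" "finite ?N" "\<forall>e\<in>?E. card e = 2" "v \<notin> \<Union>?E" "v \<notin> ?N"
      using Suc.prems by auto
    show "edge_col ?E ?C \<beta>" using \<beta> unfolding edge_col_def by auto
    show "card ?N \<le> card ?C" using u c Suc.prems(1,3,8) by simp
    show "\<forall>z\<in>?N. S z \<subseteq> ?C - color_set ?E \<beta> z"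
      using S(1) uniq unfolding color_set_def incident_edges_def by blast
    show "\<forall>z\<in>?N. (if z = w' then 1 else 2) \<le> card (S z)" using S(2) by (auto simp: r_def)
  qed
  then obtain \<gamma> where \<gamma>: "edge_col (?E \<union> (\<lambda>u. {v, u}) ` ?N) ?C \<gamma>" by blast
  \<comment> \<open>The restored color class is a matching: \<open>u\<close> misses \<open>c\<close>
    under \<open>\<beta>\<close>, and \<open>v\<close> lies on no edge of \<open>E\<close>.\<close>
  define M where "M = insert {v, u} {e \<in> E. \<beta> e = c}"
  have cu: "c \<notin> color_set E \<beta> u" using S(1) u by blast
  have M: "e = f" if "e \<in> M" "f \<in> M" "e \<inter> f \<noteq> {}" for e f
  proof -
    have "{v, u} \<inter> e = {}" if "e \<in> E" "\<beta> e = c" for e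
      using that cu Suc.prems(6) by (auto simp: color_set_iff)
    then show ?thesis using that edge_colD[OF \<beta>] unfolding M_def by blast
  qed
  have split: "E \<union> (\<lambda>u. {v, u}) ` N = (?E \<union> (\<lambda>u. {v, u}) ` ?N) \<union> M"
  proof -
    have "(\<lambda>u. {v, u}) ` N = insert {v, u} ((\<lambda>u. {v, u}) ` ?N)" using u(1) by blast
    then show ?thesis unfolding M_def by blast
  qed
  have "edge_col (E \<union> (\<lambda>u. {v, u}) ` N) C (\<lambda>e. if e \<in> M then c else \<gamma> e)"
    unfolding edge_col_def
  proof (intro conjI ballI impI)
    have G: "e \<in> ?E \<union> (\<lambda>u. {v, u}) ` ?N" if "e \<in> E \<union> (\<lambda>u. {v, u}) ` N" "e \<notin> M" for e
      using that unfolding split by blast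
    have "(if e \<in> M then c else \<gamma> e) \<in> C" if "e \<in> E \<union> (\<lambda>u. {v, u}) ` N" for e
      using edge_col_mem[OF \<gamma> G[OF that]] c by auto
    then show "(\<lambda>e. if e \<in> M then c else \<gamma> e) ` (E \<union> (\<lambda>u. {v, u}) ` N) \<subseteq> C" by blast
    fix e f
    assume ef: "e \<in> E \<union> (\<lambda>u. {v, u}) ` N" "f \<in> E \<union> (\<lambda>u. {v, u}) ` N" "e \<noteq> f \<and> e \<inter> f \<noteq> {}"
    show "(if e \<in> M then c else \<gamma> e) \<noteq> (if f \<in> M then c else \<gamma> f)"
    proof (cases "e \<in> M"; cases "f \<in> M")
      assume "e \<in> M" "f \<in> M"
      then show ?thesis using M ef by blast
    next
      assume m: "e \<in> M" "f \<notin> M"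
      show ?thesis using edge_col_mem[OF \<gamma> G[OF ef(2) m(2)]] m by auto
    next
      assume m: "e \<notin> M" "f \<in> M"
      show ?thesis using edge_col_mem[OF \<gamma> G[OF ef(1) m(1)]] m by auto
    next
      assume m: "e \<notin> M" "f \<notin> M"
      show ?thesis using edge_colD[OF \<gamma> G[OF ef(1) m(1)] G[OF ef(2) m(2)]] m ef by auto
    qed
  qed
  then show ?case by blast
qed

section \<open>Degrees and the Vizing-Fournier theorem\<close>

lemma finite_edges: "finite V \<Longrightarrow> \<forall>e\<in>E. e \<subseteq> V \<and> card e = 2 \<Longrightarrow> finite E"
  by (rule finite_subset[of E "Pow V"]) auto

lemma degree_mono: "finite E \<Longrightarrow> F \<subseteq> E \<Longrightarrow> degree F v \<le> degree E v"
  unfolding degree_def incident_edges_def by (rule card_mono) auto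

lemma degree_less:
  "finite E \<Longrightarrow> F \<subseteq> E \<Longrightarrow> e \<in> E \<Longrightarrow> e \<notin> F \<Longrightarrow> v \<in> e \<Longrightarrow> degree F v < degree E v"
  unfolding degree_def incident_edges_def by (rule psubset_card_mono) auto

lemma degree_pos_iff: "finite E \<Longrightarrow> 1 \<le> degree E v \<longleftrightarrow> (\<exists>e\<in>E. v \<in> e)"
  unfolding degree_def incident_edges_def by (auto simp: Suc_le_eq card_gt_0_iff)

lemma degree_Diff: "finite E \<Longrightarrow> F \<subseteq> E \<Longrightarrow> degree (E - F) v + degree F v = degree E v"
proof -
  assume a: "finite E" "F \<subseteq> E"
  have "incident_edges E v = incident_edges (E - F) v \<union> incident_edges F v"
    using a unfolding incident_edges_def by blast
  moreover have "card (incident_edges (E - F) v \<union> incident_edges F v) =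
      card (incident_edges (E - F) v) + card (incident_edges F v)"
    by (rule card_Un_disjoint) (use a finite_subset[OF a(2,1)] in \<open>auto simp: incident_edges_def\<close>)
  ultimately show ?thesis unfolding degree_def by simp
qed

lemma card_color_set: "edge_col E C \<alpha> \<Longrightarrow> card (color_set E \<alpha> v) = degree E v"
  unfolding color_set_def degree_def
  by (rule card_image) (auto simp: inj_on_def incident_edges_def dest: edge_colD)

lemma color_set_subset: "edge_col E C \<alpha> \<Longrightarrow> color_set E \<alpha> v \<subseteq> C"
  using edge_col_mem by (auto simp: color_set_iff)

text \<open>Vertices are removed one at a time, one of degree \<open>k\<close> first if there is
  any. Such a vertex has at most one neighbour of degree \<open>k\<close>, which becomes the
  exceptional vertex of \<open>extend_coloring\<close>.\<close>

lemma core_coloring: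
  assumes "finite V" "\<forall>e\<in>E. e \<subseteq> V \<and> card e = 2" "\<forall>v\<in>V. degree E v \<le> k"
    and "\<forall>v x y. {v, x} \<in> E \<and> {v, y} \<in> E \<and> degree E v = k \<and> degree E x = k \<and> degree E y = k
      \<longrightarrow> x = y"
  shows "\<exists>\<alpha>. edge_col E {1..k} \<alpha>"
  using assms
proof (induction "card V" arbitrary: V E)
  case 0
  then have "E = {}" by fastforce
  then show ?case unfolding edge_col_def by auto
next
  case (Suc n)
  have finE: "finite E" by (rule finite_edges[OF Suc.prems(1,2)])
  have "V \<noteq> {}" using Suc.hyps(2) by auto
  then obtain v where v: "v \<in> V" "\<And>x. x \<in> V \<Longrightarrow> degree E x = k \<Longrightarrow> degree E v = k" by blast
  define E0 N where "E0 = {e \<in> E. v \<notin> e}" and "N = {u. {v, u} \<in> E}"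
  have E0: "E0 \<subseteq> E" unfolding E0_def by blast
  have two: "u \<noteq> v \<and> u \<in> V" if "u \<in> N" for u
    using that Suc.prems(2) unfolding N_def by fastforce
  have finN: "finite N" by (rule finite_subset[OF _ Suc.prems(1)]) (use two in blast)
  have inc: "incident_edges E v = (\<lambda>u. {v, u}) ` N"
  proof
    show "incident_edges E v \<subseteq> (\<lambda>u. {v, u}) ` N"
    proof
      fix e assume e: "e \<in> incident_edges E v"
      then have "card e = 2" "v \<in> e" using Suc.prems(2) unfolding incident_edges_def by auto
      then obtain u where "e = {v, u}" by (metis card_2_iff doubleton_eq_iff insertE singletonD)
      then show "e \<in> (\<lambda>u. {v, u}) ` N" using e unfolding N_def incident_edges_def by auto
    qed
  qed (auto simp: N_def incident_edges_def)
  have "card N = degree E v" unfolding degree_def inc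
    by (rule card_image[symmetric]) (auto simp: inj_on_def doubleton_eq_iff)
  then have cardN: "card N \<le> card {1..k}" using Suc.prems(3) v(1) by simp
  have "\<exists>\<alpha>. edge_col E0 {1..k} \<alpha>"
  proof (rule Suc.hyps(1))
    show "n = card (V - {v})" using Suc.hyps(2) Suc.prems(1) v(1) by simp
    show "finite (V - {v})" using Suc.prems(1) by simp
    show "\<forall>e\<in>E0. e \<subseteq> V - {v} \<and> card e = 2" using Suc.prems(2) unfolding E0_def by auto
    show "\<forall>x\<in>V - {v}. degree E0 x \<le> k"
      using Suc.prems(3) degree_mono[OF finE E0] order_trans by blast
    \<comment> \<open>Degrees only drop, so a vertex of degree \<open>k\<close> in \<open>E0\<close>
      already had degree \<open>k\<close> in \<open>E\<close>; hence the core condition is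
      inherited.\<close>
    have deg: "degree E x = k" if "{x, y} \<in> E0" "degree E0 x = k" for x y
      using that Suc.prems(2,3) degree_mono[OF finE E0, of x] E0 by force
    show "\<forall>x y z. {x, y} \<in> E0 \<and> {x, z} \<in> E0 \<and> degree E0 x = k \<and> degree E0 y = k \<and>
        degree E0 z = k \<longrightarrow> y = z"
      using Suc.prems(4) deg E0 by (metis insert_commute subsetD)
  qed
  then obtain \<alpha> where \<alpha>: "edge_col E0 {1..k} \<alpha>" by blast
  have "\<exists>w. \<forall>u\<in>N. u \<noteq> w \<longrightarrow> degree E u < k"
  proof (cases "\<exists>w\<in>N. degree E w = k")
    case True
    then obtain w where w: "w \<in> N" "degree E w = k" by blast
    then have "degree E v = k" using v(2) two by blast
    then have "\<forall>u\<in>N. u \<noteq> w \<longrightarrow> degree E u \<noteq> k"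
      using Suc.prems(4) w unfolding N_def by blast
    then show ?thesis using Suc.prems(3) two le_neq_implies_less by metis
  next
    case False
    then show ?thesis using Suc.prems(3) two le_neq_implies_less by metis
  qed
  then obtain w where w: "\<forall>u\<in>N. u \<noteq> w \<longrightarrow> degree E u < k" by blast
  have "\<exists>\<beta>. edge_col (E0 \<union> (\<lambda>u. {v, u}) ` N) {1..k} \<beta>"
  proof (rule extend_coloring[OF _ _ finN _ \<alpha> _ _ cardN, of _ "\<lambda>u. {1..k} - color_set E0 \<alpha> u" w])
    show "\<forall>u\<in>N. (if u = w then 1 else 2) \<le> card ({1..k} - color_set E0 \<alpha> u)"
    proof
      fix u assume u: "u \<in> N"
      \<comment> \<open>Losing the edge \<open>{v, u}\<close> frees a color at \<open>u\<close>: at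
        least one is free at \<open>w\<close> and two at every other neighbour.\<close>
      have "degree E0 u < degree E u"
        by (rule degree_less[OF finE E0, of "{v, u}"]) (use u in \<open>auto simp: N_def E0_def\<close>)
      moreover have "degree E u \<le> k" "u \<noteq> w \<Longrightarrow> degree E u < k"
        using Suc.prems(3) two u w by auto
      moreover have "card ({1..k} - color_set E0 \<alpha> u) = k - degree E0 u"
        using card_Diff_subset[OF _ color_set_subset[OF \<alpha>, of u]] color_set_subset[OF \<alpha>, of u]
        by (simp add: card_color_set[OF \<alpha>] finite_subset)
      ultimately show "(if u = w then 1 else 2) \<le> card ({1..k} - color_set E0 \<alpha> u)" by auto
    qed
  qed (use finE Suc.prems(2) two in \<open>auto simp: E0_def\<close>)
  moreover have "E = E0 \<union> (\<lambda>u. {v, u}) ` N"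
    unfolding inc[symmetric] E0_def incident_edges_def by blast
  ultimately show ?case by simp
qed

lemma edge_col_insert:
  assumes \<phi>: "edge_col F C \<phi>" and c: "c \<in> C" and e: "e \<notin> F"
    and new: "\<And>f. f \<in> F \<Longrightarrow> e \<inter> f \<noteq> {} \<Longrightarrow> \<phi> f \<noteq> c"
  shows "edge_col (insert e F) C (\<phi>(e := c))"
  unfolding edge_col_def
proof (intro conjI ballI impI)
  show "(\<phi>(e := c)) ` insert e F \<subseteq> C" using edge_col_mem[OF \<phi>] c by auto
  fix f g assume fg: "f \<in> insert e F" "g \<in> insert e F" "f \<noteq> g \<and> f \<inter> g \<noteq> {}"
  then obtain x where "x \<in> f" "x \<in> g" by blast
  then show "(\<phi>(e := c)) f \<noteq> (\<phi>(e := c)) g"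
    using fg e new[of f] new[of g] edge_colD[OF \<phi>, of f g x]
    by (cases "f = e"; cases "g = e") auto
qed

section \<open>A two-colored subgraph covering the vertices of maximum degree\<close>

locale bounded_degree_graph =
  fixes V :: "'a set" and E :: "'a set set" and D :: nat
  assumes finV: "finite V" and edges: "\<forall>e\<in>E. e \<subseteq> V \<and> card e = 2"
    and deg_le: "\<forall>v\<in>V. degree E v \<le> D" and D_pos: "0 < D"
begin

definition A where "A = {v\<in>V. degree E v = D}"
definition B where "B = {v\<in>V. degree E v + 1 = D}"
text \<open>Addition avoids truncated subtraction: for \<open>D = 1\<close> the value
  \<open>D - 2\<close> would be 0, and isolated vertices would belong to both \<open>B\<close> and
  \<open>C\<close>.\<close>

definition C where "C = {v\<in>V. degree E v + 2 = D}"

text \<open>Covering \<open>A\<close> lowers all degrees of the remaining graph to at most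
  \<open>D - 1\<close>. The last two clauses assign to every vertex of \<open>C\<close> on an edge
  of \<open>F\<close> its own neighbour in \<open>A\<close>.\<close>

definition admissible :: "'a set set \<Rightarrow> bool" where
  "admissible F \<longleftrightarrow> F \<subseteq> E \<and> (\<exists>\<phi>. edge_col F {D, D + 1} \<phi>) \<and>
     (\<forall>v\<in>A. 1 \<le> degree F v) \<and> (\<forall>v\<in>B. degree F v \<le> 1) \<and>
     (\<forall>x c d. {x, c} \<in> F \<and> {x, d} \<in> F \<and> c \<in> C \<and> d \<in> C \<and> x \<in> A \<longrightarrow> c = d) \<and>
     (\<forall>e\<in>F. e \<inter> C \<noteq> {} \<longrightarrow> e \<inter> A \<noteq> {})"

lemma admissibleD:
  assumes "admissible F"
  shows "F \<subseteq> E" "\<exists>\<phi>. edge_col F {D, D + 1} \<phi>"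
    "v \<in> A \<Longrightarrow> 1 \<le> degree F v" "v \<in> B \<Longrightarrow> degree F v \<le> 1"
    "{x, c} \<in> F \<Longrightarrow> {x, d} \<in> F \<Longrightarrow> c \<in> C \<Longrightarrow> d \<in> C \<Longrightarrow> x \<in> A \<Longrightarrow> c = d"
    "e \<in> F \<Longrightarrow> e \<inter> C \<noteq> {} \<Longrightarrow> e \<inter> A \<noteq> {}"
  using assms unfolding admissible_def by simp_all

lemma admissibleI:
  assumes "F \<subseteq> E" "edge_col F {D, D + 1} \<phi>"
    and "\<And>v. v \<in> A \<Longrightarrow> 1 \<le> degree F v" "\<And>v. v \<in> B \<Longrightarrow> degree F v \<le> 1"
    and "\<And>x c d. {x, c} \<in> F \<Longrightarrow> {x, d} \<in> F \<Longrightarrow> c \<in> C \<Longrightarrow> d \<in> C \<Longrightarrow> x \<in> A \<Longrightarrow> c = d"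
    and "\<And>e. e \<in> F \<Longrightarrow> e \<inter> C \<noteq> {} \<Longrightarrow> e \<inter> A \<noteq> {}"
  shows "admissible F"
  unfolding admissible_def
proof (intro conjI allI ballI impI exI[of _ \<phi>])
  show "c = d" if "{x, c} \<in> F \<and> {x, d} \<in> F \<and> c \<in> C \<and> d \<in> C \<and> x \<in> A" for x c d
    using assms(5)[of x c d] that by simp
qed (use assms in simp_all)

lemma finE: "finite E"
  by (rule finite_edges[OF finV edges])

lemma disjoint: "A \<inter> B = {}" "A \<inter> C = {}" "B \<inter> C = {}"
  unfolding A_def B_def C_def by auto

text \<open>A matching of largest size in the graph induced by \<open>A\<close>; an edge avoiding it
  could be added. So the vertices of \<open>A\<close> that it misses are independent.\<close>

lemma maximal_matching:
  obtains M where "\<forall>e\<in>M. e \<in> E \<and> e \<subseteq> A" "\<forall>e\<in>M. \<forall>f\<in>M. e \<noteq> f \<longrightarrow> e \<inter> f = {}"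
    "\<forall>e\<in>E. e \<subseteq> A \<longrightarrow> e \<inter> \<Union>M \<noteq> {}"
proof -
  let ?P = "\<lambda>M. (\<forall>e\<in>M. e \<in> E \<and> e \<subseteq> A) \<and> (\<forall>e\<in>M. \<forall>f\<in>M. e \<noteq> f \<longrightarrow> e \<inter> f = {})"
  have fin: "finite M \<and> card M \<le> card E" if "?P M" for M
  proof -
    have "M \<subseteq> E" using conjunct1[OF that] by blast
    then show ?thesis using finE card_mono finite_subset by blast
  qed
  have "?P {}" by simp
  moreover have "\<forall>M. ?P M \<longrightarrow> card M < Suc (card E)"
    by (intro allI impI le_imp_less_Suc conjunct2[OF fin])
  ultimately have "\<exists>M. ?P M \<and> (\<forall>M'. ?P M' \<longrightarrow> card M' \<le> card M)"
    by (rule ex_has_greatest_nat)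
  then obtain M where M_max: "?P M \<and> (\<forall>M'. ?P M' \<longrightarrow> card M' \<le> card M)" ..
  note M = conjunct1[OF M_max] and max = mp[OF spec[OF conjunct2[OF M_max]]]
  have "e \<inter> \<Union>M \<noteq> {}" if e: "e \<in> E" "e \<subseteq> A" for e
  proof
    assume dis: "e \<inter> \<Union>M = {}"
    have "e \<noteq> {}" using bspec[OF edges e(1)] by auto
    then have "e \<notin> M" using dis by (metis Int_absorb2 Union_upper)
    moreover have "?P (insert e M)"
    proof (intro conjI ballI impI)
      show "f \<in> E" "f \<subseteq> A" if "f \<in> insert e M" for f using that e conjunct1[OF M] by auto
      show "f \<inter> g = {}" if "f \<in> insert e M" "g \<in> insert e M" "f \<noteq> g" for f g
        using that dis bspec[OF bspec[OF conjunct2[OF M]], of f g] by blast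
    qed
    ultimately show False using max[of "insert e M"] fin[OF M] by simp
  qed
  then have "\<forall>e\<in>E. e \<subseteq> A \<longrightarrow> e \<inter> \<Union>M \<noteq> {}" by blast
  then show ?thesis by (rule that[OF conjunct1[OF M] conjunct2[OF M]])
qed

text \<open>After the removal of a maximal matching \<open>M\<close> of \<open>G[A]\<close> the vertices of degree \<open>D\<close> are
  independent, so the rest is \<open>D\<close>-colorable and each of these vertices sees color 1.\<close>

lemma admissible_exists: "\<exists>F. admissible F"
proof -
  obtain M where M: "\<forall>e\<in>M. e \<in> E \<and> e \<subseteq> A" "\<forall>e\<in>M. \<forall>f\<in>M. e \<noteq> f \<longrightarrow> e \<inter> f = {}"
    "\<forall>e\<in>E. e \<subseteq> A \<longrightarrow> e \<inter> \<Union>M \<noteq> {}" by (rule maximal_matching)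
  define U E1 where "U = A - \<Union>M" and "E1 = E - M"
  have E1: "E1 \<subseteq> E" unfolding E1_def by blast
  \<comment> \<open>Only vertices of \<open>A\<close> have degree \<open>D\<close>, and those
    covered by \<open>M\<close> lose an edge.\<close>
  have core: "v \<in> U" if "v \<in> V" "degree E1 v = D" for v
  proof -
    have "degree E v = D" using that bspec[OF deg_le] degree_mono[OF finE E1, of v] by fastforce
    moreover have "v \<notin> \<Union>M"
    proof
      assume "v \<in> \<Union>M"
      then obtain e where "e \<in> M" "v \<in> e" by blast
      then have "degree E1 v < degree E v"
        by (intro degree_less[OF finE E1, of e]) (use M in \<open>auto simp: E1_def\<close>)
      then show False using that \<open>degree E v = D\<close> by simp
    qed
    ultimately show ?thesis using that unfolding U_def A_def by blast
  qed
  have "\<exists>\<gamma>. edge_col E1 {1..D} \<gamma>"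
  proof (rule core_coloring[OF finV])
    show "\<forall>e\<in>E1. e \<subseteq> V \<and> card e = 2" using edges E1 by blast
    show "\<forall>v\<in>V. degree E1 v \<le> D" using deg_le degree_mono[OF finE E1] order_trans by blast
    have "\<not> ({v, x} \<in> E1 \<and> degree E1 v = D \<and> degree E1 x = D)" for v x
    proof
      assume a: "{v, x} \<in> E1 \<and> degree E1 v = D \<and> degree E1 x = D"
      then have e: "{v, x} \<in> E" using E1 by blast
      then have "v \<in> V" "x \<in> V" using bspec[OF edges e] by simp_all
      then have "v \<in> U" "x \<in> U" using core a by simp_all
      with e show False using bspec[OF M(3), of "{v, x}"] unfolding U_def by simp
    qed
    then show "\<forall>v x y. {v, x} \<in> E1 \<and> {v, y} \<in> E1 \<and> degree E1 v = D \<and> degree E1 x = D \<and>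
        degree E1 y = D \<longrightarrow> x = y" by blast
  qed
  then obtain \<gamma> where \<gamma>: "edge_col E1 {1..D} \<gamma>" by blast
  \<comment> \<open>A vertex of \<open>U\<close> loses no edge, so its \<open>D\<close> edges use
    all \<open>D\<close> colors, in particular color 1.\<close>
  have cover: "\<exists>e\<in>E1. u \<in> e \<and> \<gamma> e = 1" if u: "u \<in> U" for u
  proof -
    have "incident_edges E1 u = incident_edges E u"
      using u unfolding U_def E1_def incident_edges_def by blast
    then have "degree E1 u = D" using u unfolding U_def A_def degree_def by simp
    then have "card (color_set E1 \<gamma> u) = card {1..D}" using card_color_set[OF \<gamma>] by simp
    then have "color_set E1 \<gamma> u = {1..D}"
      using color_set_subset[OF \<gamma>] by (intro card_subset_eq) auto
    then show ?thesis using D_pos color_set_iff[of 1 E1 \<gamma> u] by auto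
  qed
  \<comment> \<open>Only the edges of color 1 at \<open>U\<close> are kept: each of them meets
    \<open>A\<close>, as the last clause of \<open>admissible\<close> demands.\<close>
  define N where "N = {e\<in>E1. \<gamma> e = 1 \<and> e \<inter> U \<noteq> {}}"
  have N: "e = f" if "e \<in> N" "f \<in> N" "x \<in> e" "x \<in> f" for e f x
    using that edge_colD[OF \<gamma>, of e f x] unfolding N_def by simp
  have disj: "e \<notin> N" if "e \<in> M" for e using that unfolding N_def E1_def by blast
  have sub: "M \<union> N \<subseteq> E" using M(1) E1 unfolding N_def by blast
  have "edge_col (M \<union> N) {D, D + 1} (\<lambda>e. if e \<in> M then D else D + 1)"
    unfolding edge_col_def
  proof (intro conjI ballI impI)
    fix e f assume ef: "e \<in> M \<union> N" "f \<in> M \<union> N" "e \<noteq> f \<and> e \<inter> f \<noteq> {}"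
    then obtain x where x: "x \<in> e" "x \<in> f" by blast
    have "\<not> (e \<in> M \<and> f \<in> M)" using bspec[OF bspec[OF M(2)], of e f] ef(3) by blast
    moreover have "\<not> (e \<in> N \<and> f \<in> N)" using N[OF _ _ x] ef(3) by blast
    ultimately show "(if e \<in> M then D else D + 1) \<noteq> (if f \<in> M then D else D + 1)"
      using ef(1,2) by auto
  qed auto
  moreover have "1 \<le> degree (M \<union> N) v" if "v \<in> A" for v
  proof -
    have "\<exists>e\<in>M \<union> N. v \<in> e"
      using that cover[of v] unfolding U_def N_def by blast
    then show ?thesis using degree_pos_iff[OF finite_subset[OF sub finE]] by simp
  qed
  moreover have "degree (M \<union> N) v \<le> 1" if v: "v \<in> B" for v
  proof -
    have inN: "e \<in> N \<and> v \<in> e" if "e \<in> incident_edges (M \<union> N) v" for e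
      using that M(1) v disjoint(1) unfolding incident_edges_def by blast
    have "e = f" if "e \<in> incident_edges (M \<union> N) v" "f \<in> incident_edges (M \<union> N) v" for e f
      using N[of e f v] inN[OF that(1)] inN[OF that(2)] by simp
    moreover have "finite (incident_edges (M \<union> N) v)"
      using finite_subset[OF sub finE] unfolding incident_edges_def by simp
    ultimately show ?thesis unfolding degree_def One_nat_def
      by (simp add: card_le_Suc0_iff_eq)
  qed
  moreover have "c = d" if "{x, c} \<in> M \<union> N" "{x, d} \<in> M \<union> N" "c \<in> C" "d \<in> C" for x c d
  proof -
    have "{x, c} \<in> N" "{x, d} \<in> N" using that M(1) disjoint(2) by blast+
    from N[OF this, of x] show ?thesis by (auto simp: doubleton_eq_iff)
  qed
  moreover have "e \<inter> A \<noteq> {}" if "e \<in> M \<union> N" "e \<inter> C \<noteq> {}" for e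
    using that M(1) disjoint(2) unfolding N_def U_def by blast
  ultimately have "admissible (M \<union> N)" using sub by (intro admissibleI)
  then show ?thesis by blast
qed

text \<open>Both ends lie in \<open>A\<close> or \<open>B\<close>, so the clauses about
  \<open>C\<close> concern old edges only, and an end in \<open>B\<close> had no edge of
  \<open>F\<close> before. The color \<open>c\<close> is free at both ends.\<close>

lemma admissible_insert:
  assumes F: "admissible F" and e: "{x, y} \<in> E" "{x, y} \<notin> F"
    and xy: "\<forall>p\<in>{x, y}. p \<in> A \<or> p \<in> B \<and> degree F p = 0"
    and \<phi>: "edge_col F {D, D + 1} \<phi>"
    and c: "c \<in> {D, D + 1}" "c \<notin> color_set F \<phi> x" "c \<notin> color_set F \<phi> y"
  shows "admissible (insert {x, y} F)"
proof -
  let ?F = "insert {x, y} F"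
  have sub: "?F \<subseteq> E" using admissibleD(1)[OF F] e by blast
  have fin: "finite ?F" by (rule finite_subset[OF sub finE])
  have noC: "{x, y} \<inter> C = {}" using xy disjoint by blast
  have "\<phi> f \<noteq> c" if "f \<in> F" "{x, y} \<inter> f \<noteq> {}" for f
    using that c by (auto simp: color_set_iff)
  then have "edge_col ?F {D, D + 1} (\<phi>({x, y} := c))"
    by (intro edge_col_insert[OF \<phi> c(1) e(2)])
  moreover have "1 \<le> degree ?F v" if "v \<in> A" for v
    using admissibleD(3)[OF F that] degree_mono[OF fin subset_insertI, of v] by (rule order_trans)
  moreover have "degree ?F v \<le> 1" if v: "v \<in> B" for v
  proof (cases "v \<in> {x, y}")
    case True
    moreover have "v \<notin> A" using v disjoint(1) by blast
    ultimately have "degree F v = 0" using bspec[OF xy, of v] by simp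
    moreover have "incident_edges ?F v = insert {x, y} (incident_edges F v)"
      using True unfolding incident_edges_def by auto
    ultimately show ?thesis unfolding degree_def by (simp add: card_insert_le_m1)
  next
    case False
    then have "incident_edges ?F v = incident_edges F v" unfolding incident_edges_def by auto
    then show ?thesis using admissibleD(4)[OF F v] unfolding degree_def by simp
  qed
  moreover have old: "f \<in> F" if "f \<in> ?F" "f \<inter> C \<noteq> {}" for f
    using that noC by blast
  moreover have "q = r" if "{p, q} \<in> ?F" "{p, r} \<in> ?F" "q \<in> C" "r \<in> C" "p \<in> A" for p q r
    using that by (intro admissibleD(5)[OF F, of p q r] old) auto
  moreover have "f \<inter> A \<noteq> {}" if "f \<in> ?F" "f \<inter> C \<noteq> {}" for f
    using that by (intro admissibleD(6)[OF F] old)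
  ultimately show ?thesis using sub by (intro admissibleI)
qed

text \<open>If \<open>x\<close> had two neighbours \<open>y\<close>, \<open>z\<close> in the core, then the Kempe component of \<open>x\<close> would omit one
  of them; after a change on it \<open>x\<close> and this neighbour miss a common color, so \<open>F\<close> can be enlarged.\<close>

lemma admissible_core:
  obtains F where "admissible F"
    "\<forall>x y z. {x, y} \<in> E - F \<and> {x, z} \<in> E - F \<and> degree (E - F) x = D - 1 \<and>
       degree (E - F) y = D - 1 \<and> degree (E - F) z = D - 1 \<longrightarrow> y = z"
proof -
  have "\<exists>F. admissible F \<and> (\<forall>F'. admissible F' \<longrightarrow> card F' \<le> card F)"
  proof -
    obtain F0 where "admissible F0" using admissible_exists by blast
    moreover have "\<forall>F. admissible F \<longrightarrow> card F < Suc (card E)"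
      using finE unfolding admissible_def by (auto simp: less_Suc_eq_le intro: card_mono)
    ultimately show ?thesis by (rule ex_has_greatest_nat)
  qed
  then obtain F where F_max: "admissible F \<and> (\<forall>F'. admissible F' \<longrightarrow> card F' \<le> card F)" ..
  note F = conjunct1[OF F_max] and max = mp[OF spec[OF conjunct2[OF F_max]]]
  have FE: "F \<subseteq> E" by (rule admissibleD[OF F])
  have finF: "finite F" by (rule finite_subset[OF FE finE])
  obtain \<phi>0 where \<phi>0: "edge_col F {D, D + 1} \<phi>0" using admissibleD(2)[OF F] by blast
  \<comment> \<open>\<open>K\<close> contains the vertices that still have degree
    \<open>D - 1\<close> outside \<open>F\<close>, as \<open>inK\<close> shows below: one edge of
    \<open>F\<close> at a vertex of \<open>A\<close>, none at a vertex of \<open>B\<close>.\<close>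
  define K where "K = {x. (x \<in> A \<or> x \<in> B \<and> degree F x = 0) \<and> degree F x \<le> 1 \<and> x \<in> V}"
  \<comment> \<open>By maximality of \<open>F\<close>, whatever coloring of \<open>F\<close> is
    chosen, two vertices of \<open>K\<close> joined outside \<open>F\<close> never miss the same
    color.\<close>
  have no_common: "c \<in> color_set F \<phi> x \<union> color_set F \<phi> y"
    if "edge_col F {D, D + 1} \<phi>" "{x, y} \<in> E - F" "x \<in> K" "y \<in> K" "c \<in> {D, D + 1}" for \<phi> c x y
  proof (rule ccontr)
    assume "\<not> ?thesis"
    then have "admissible (insert {x, y} F)"
      using that by (intro admissible_insert[OF F _ _ _ that(1)]) (auto simp: K_def)
    from max[OF this] show False using that(2) finF by simp
  qed
  have single: "\<exists>i. color_set F \<phi> x \<subseteq> {i}" if "edge_col F {D, D + 1} \<phi>" "x \<in> K" for \<phi> x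
  proof -
    have "card (color_set F \<phi> x) \<le> Suc 0" using card_color_set[OF that(1)] that(2) unfolding K_def by simp
    moreover have "finite (color_set F \<phi> x)"
      using finF unfolding color_set_def incident_edges_def by simp
    ultimately have "\<forall>a\<in>color_set F \<phi> x. \<forall>b\<in>color_set F \<phi> x. a = b"
      by (simp add: card_le_Suc0_iff_eq)
    then show ?thesis by blast
  qed
  have core: "y = z" if e: "{x, y} \<in> E - F" "{x, z} \<in> E - F" and K: "x \<in> K" "y \<in> K" "z \<in> K" for x y z
  proof (rule ccontr)
    assume ne: "y \<noteq> z"
    \<comment> \<open>\<open>j\<close> is the only color that \<open>x\<close> can see,
      \<open>i\<close> the other one.\<close>
    obtain i j where ij: "{i, j} = {D, D + 1}" "color_set F \<phi>0 x \<subseteq> {j}" "i \<noteq> j"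
    proof -
      obtain k where k: "color_set F \<phi>0 x \<subseteq> {k}" using single[OF \<phi>0 K(1)] by blast
      show ?thesis
      proof (cases "k = D")
        case True
        then show ?thesis using that[of "D + 1" D] k by auto
      next
        case False
        then show ?thesis using that[of D "D + 1"] k color_set_subset[OF \<phi>0, of x] by auto
      qed
    qed
    \<comment> \<open>As \<open>x\<close> misses \<open>i\<close>, both neighbours see
      \<open>i\<close> and nothing else; they miss \<open>j\<close>, so \<open>x\<close> sees
      \<open>j\<close>.\<close>
    have "i \<in> color_set F \<phi>0 p" if "p \<in> {y, z}" for p
      using no_common[OF \<phi>0 _ K(1), of p i] that e K ij by blast
    then have yz: "color_set F \<phi>0 p = {i}" if "p \<in> {y, z}" for p
      using single[OF \<phi>0, of p] that K by blast
    have x: "color_set F \<phi>0 x = {j}"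
      using no_common[OF \<phi>0 e(1) K(1,2), of j] yz[of y] ij by auto
    have two: "\<forall>e\<in>F. card e = 2" using FE edges by blast
    have cl: "kempe_closed F \<phi>0 i j V" using FE edges unfolding kempe_closed_def by blast
    have "x \<in> V" using K unfolding K_def by blast
    from kempe_component[OF \<phi>0 two finV cl this]
    obtain W where W: "W \<subseteq> V" "x \<in> W" "kempe_closed F \<phi>0 i j W"
      "card {p \<in> W. i \<notin> color_set F \<phi>0 p} + card {p \<in> W. j \<notin> color_set F \<phi>0 p} \<le> 2" by blast
    have finW: "finite W" using W(1) finV finite_subset by blast
    \<comment> \<open>If \<open>W\<close> contained both neighbours, it would have three open slots:
      \<open>j\<close> at \<open>y\<close> and \<open>z\<close>, and \<open>i\<close> at
      \<open>x\<close>.\<close>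
    obtain p where p: "p \<in> {y, z}" "p \<notin> W"
    proof (rule ccontr)
      assume "\<not> thesis"
      then have "y \<in> W" "z \<in> W" using that by blast+
      then have "{y, z} \<subseteq> {p \<in> W. j \<notin> color_set F \<phi>0 p}" using yz ij(3) by auto
      from card_mono[OF _ this] have "2 \<le> card {p \<in> W. j \<notin> color_set F \<phi>0 p}"
        using ne finW by simp
      moreover have "0 < card {p \<in> W. i \<notin> color_set F \<phi>0 p}"
        using finW W(2) x ij(3) by (auto simp: card_gt_0_iff)
      ultimately show False using W(4) by linarith
    qed
    let ?\<phi> = "kempe_swap i j W \<phi>0"
    have \<phi>: "edge_col F {D, D + 1} ?\<phi>" by (rule edge_col_kempe_swap[OF \<phi>0 W(3)]) (use ij(1) in auto)
    \<comment> \<open>The change turns the color at \<open>x\<close> into \<open>i\<close> and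
      leaves \<open>p\<close> alone, so both now miss \<open>j\<close>.\<close>
    have "color_set F ?\<phi> x = {i}" "color_set F ?\<phi> p = {i}"
      unfolding color_set_kempe_swap[OF two W(3)] using W(2) p x yz by auto
    moreover have "j \<in> {D, D + 1}" using ij(1) by blast
    moreover have "{x, p} \<in> E - F" "p \<in> K" using p e K by auto
    ultimately show False using no_common[OF \<phi>, of x p j] K(1) ij(3) by simp
  qed
  have inK: "x \<in> K" if "{x, y} \<in> E" "degree (E - F) x = D - 1" for x y
  proof -
    have x: "x \<in> V" using that edges by blast
    then have "degree E x \<le> D" using deg_le by blast
    moreover have "degree E x = D \<Longrightarrow> 1 \<le> degree F x"
      using admissibleD(3)[OF F, of x] x unfolding A_def by simp
    moreover have "degree E x + 1 = D \<Longrightarrow> degree F x = 0" "degree E x = D \<Longrightarrow> degree F x \<le> 1"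
      "D \<le> degree E x + 1"
      using degree_Diff[OF finE FE, of x] that(2) D_pos by linarith+
    ultimately show ?thesis using x unfolding K_def A_def B_def by force
  qed
  show ?thesis
  proof (rule that[OF F], intro allI impI, elim conjE)
    fix x y z
    assume a: "{x, y} \<in> E - F" "{x, z} \<in> E - F" "degree (E - F) x = D - 1"
      "degree (E - F) y = D - 1" "degree (E - F) z = D - 1"
    have "x \<in> K" "y \<in> K" "z \<in> K"
      using a inK[of x y] inK[of y x] inK[of z x] by (auto simp: insert_commute)
    then show "y = z" using core a by blast
  qed
qed

text \<open>\<open>F\<close> takes the colors \<open>D\<close> and \<open>D + 1\<close>, the rest is
  colored with \<open>D - 1\<close> colors by \<open>core_coloring\<close>. A vertex of
  \<open>C\<close> seeing a high color is joined by \<open>F\<close> to some vertex of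
  \<open>A\<close>, and admissibility makes this choice injective.\<close>

lemma coloring_few_hits:
  obtains \<alpha> where "edge_col E {1..D + 1} \<alpha>"
    "card {c\<in>C. color_set E \<alpha> c \<inter> {D, D + 1} \<noteq> {}} \<le> card A"
proof -
  obtain F where F: "admissible F" and core:
    "\<forall>x y z. {x, y} \<in> E - F \<and> {x, z} \<in> E - F \<and> degree (E - F) x = D - 1 \<and>
       degree (E - F) y = D - 1 \<and> degree (E - F) z = D - 1 \<longrightarrow> y = z"
    by (rule admissible_core)
  have FE: "F \<subseteq> E" by (rule admissibleD[OF F])
  obtain \<phi> where \<phi>: "edge_col F {D, D + 1} \<phi>" using admissibleD(2)[OF F] by blast
  have "\<exists>\<psi>. edge_col (E - F) {1..D - 1} \<psi>"
  proof (rule core_coloring[OF finV _ _ core])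
    show "\<forall>v\<in>V. degree (E - F) v \<le> D - 1"
    proof
      fix v assume v: "v \<in> V"
      have "degree E v = D \<Longrightarrow> 1 \<le> degree F v" "degree E v \<le> D"
        using admissibleD(3)[OF F, of v] v deg_le unfolding A_def by auto
      then show "degree (E - F) v \<le> D - 1" using degree_Diff[OF finE FE, of v] by linarith
    qed
  qed (use edges in blast)
  then obtain \<psi> where \<psi>: "edge_col (E - F) {1..D - 1} \<psi>" by blast
  define \<alpha> where "\<alpha> e = (if e \<in> F then \<phi> e else \<psi> e)" for e
  have hiF: "\<alpha> e \<in> {D, D + 1}" if "e \<in> F" for e
    using that edge_col_mem[OF \<phi>] unfolding \<alpha>_def by auto
  have loF: "1 \<le> \<alpha> e \<and> \<alpha> e < D" if "e \<in> E" "e \<notin> F" for e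
    using that edge_col_mem[OF \<psi>, of e] D_pos unfolding \<alpha>_def by auto
  have \<alpha>: "edge_col E {1..D + 1} \<alpha>"
    unfolding edge_col_def
  proof (intro conjI ballI impI)
    show "\<alpha> ` E \<subseteq> {1..D + 1}"
    proof
      fix c assume "c \<in> \<alpha> ` E"
      then obtain e where "e \<in> E" "c = \<alpha> e" by blast
      then show "c \<in> {1..D + 1}" using hiF[of e] loF[of e] D_pos by (cases "e \<in> F") auto
    qed
    fix e f assume ef: "e \<in> E" "f \<in> E" "e \<noteq> f \<and> e \<inter> f \<noteq> {}"
    show "\<alpha> e \<noteq> \<alpha> f"
    proof (cases "e \<in> F \<longleftrightarrow> f \<in> F")
      case True
      then show ?thesis using ef \<phi> \<psi> unfolding edge_col_def \<alpha>_def by auto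
    next
      case False
      then show ?thesis using hiF[of e] hiF[of f] loF[of e] loF[of f] ef by auto
    qed
  qed
  let ?H = "{c\<in>C. color_set E \<alpha> c \<inter> {D, D + 1} \<noteq> {}}"
  have "\<exists>x. x \<in> A \<and> {x, c} \<in> F" if c: "c \<in> ?H" for c
  proof -
    obtain e where e: "e \<in> E" "c \<in> e" "\<alpha> e \<in> {D, D + 1}" using c by (auto simp: color_set_iff)
    then have eF: "e \<in> F" using loF[of e] by (cases "e \<in> F") auto
    obtain x where x: "x \<in> e" "x \<in> A" using admissibleD(6)[OF F eF] e(2) c by blast
    have "x \<noteq> c" using x c disjoint(2) by blast
    moreover have "card e = 2" using bspec[OF edges e(1)] by simp
    ultimately have "e = {x, c}" using e(2) x(1) by (auto simp: card_2_iff)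
    then have "{x, c} \<in> F" using eF by simp
    with x(2) show ?thesis by (intro exI conjI)
  qed
  then have "\<exists>g. \<forall>c\<in>?H. g c \<in> A \<and> {g c, c} \<in> F" by (intro bchoice ballI)
  then obtain g where g_all: "\<forall>c\<in>?H. g c \<in> A \<and> {g c, c} \<in> F" ..
  note g = bspec[OF g_all]
  have "inj_on g ?H"
  proof (rule inj_onI)
    fix c d assume cd: "c \<in> ?H" "d \<in> ?H" "g c = g d"
    then show "c = d" using g[OF cd(1)] g[OF cd(2)] admissibleD(5)[OF F, of "g c" c d] by auto
  qed
  moreover have "g ` ?H \<subseteq> A" using g by blast
  moreover have "finite A" using finV unfolding A_def by simp
  ultimately have "card ?H \<le> card A" by (rule card_inj_on_le)
  with \<alpha> show ?thesis by (rule that)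
qed

end

section \<open>Pendant edges\<close>

text \<open>This passes from added colors to pendant edges: each color of \<open>S v\<close> is
  given to one pendant edge at \<open>v\<close>. A leaf sees a single color, which is always an
  interval.\<close>

lemma cyclic_deficiency_le:
  assumes fin: "finite V" and edges: "\<forall>e\<in>E. e \<subseteq> V \<and> card e = 2"
    and \<alpha>: "edge_col E {1..t} \<alpha>"
    and S: "\<And>v. v \<in> V \<Longrightarrow> S v \<subseteq> {1..t} - color_set E \<alpha> v"
      "\<And>v. v \<in> V \<Longrightarrow> cyclic_interval t (color_set E \<alpha> v \<union> S v)"
  shows "cyclic_deficiency V E \<le> (\<Sum>v\<in>V. card (S v))"
proof -
  define m where "m v = card (S v)" for v
  have "\<exists>h. bij_betw h {..<m v} (S v)" if "v \<in> V" for v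
  proof -
    have "finite (S v)" using S(1)[OF that] finite_subset by blast
    then show ?thesis using ex_bij_betw_nat_finite unfolding m_def lessThan_atLeast0 by blast
  qed
  then have "\<exists>h. \<forall>v\<in>V. bij_betw (h v) {..<m v} (S v)" by (intro bchoice ballI)
  then obtain h where h_all: "\<forall>v\<in>V. bij_betw (h v) {..<m v} (S v)" ..
  have h: "h v ` {..<m v} = S v" "inj_on (h v) {..<m v}" if "v \<in> V" for v
    using bspec[OF h_all that] unfolding bij_betw_def by simp_all
  \<comment> \<open>An edge without an \<open>Inr\<close> vertex is an old edge and is pulled back
    along \<open>Inl\<close>; otherwise its unique leaf \<open>(v, i)\<close> determines the
    color.\<close>
  define \<beta> :: "('a + 'a \<times> nat) set \<Rightarrow> nat" where
    "\<beta> e = (if Inr -` e = {} then \<alpha> (Inl -` e) else (case the_elem (Inr -` e) of (v, i) \<Rightarrow> h v i))" for e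
  have inl: "\<beta> (Inl ` e) = \<alpha> e" for e
  proof -
    have "Inr -` (Inl ` e) = ({} :: ('a \<times> nat) set)" by auto
    moreover have "Inl -` (Inl ` e :: ('a + 'a \<times> nat) set) = e" by (simp add: inj_vimage_image_eq)
    ultimately show ?thesis unfolding \<beta>_def by simp
  qed
  have inr: "\<beta> {Inl v, Inr (v, i)} = h v i" for v i
  proof -
    have "Inr -` {Inl v :: 'a + 'a \<times> nat, Inr (v, i)} = {(v, i)}" by auto
    then show ?thesis unfolding \<beta>_def by simp
  qed
  let ?V = "pendant_verts V m" and ?E = "pendant_edges V E m"
  have pend: "\<exists>v i. f = {Inl v, Inr (v, i)} \<and> v \<in> V \<and> i < m v" if "f \<in> ?E" "f \<notin> (\<lambda>e. Inl ` e) ` E" for f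
    using that unfolding pendant_edges_def by blast
  have h_mem: "h v i \<in> S v" if "v \<in> V" "i < m v" for v i
    using h(1)[OF that(1)] that(2) by blast
  have inc_l: "incident_edges ?E (Inl v) =
      (\<lambda>e. Inl ` e) ` incident_edges E v \<union> (\<lambda>i. {Inl v, Inr (v, i)}) ` {..<m v}" if "v \<in> V" for v
    using that unfolding incident_edges_def pendant_edges_def by auto
  have inc_r: "incident_edges ?E (Inr (v, i)) = {{Inl v, Inr (v, i)}}" if "v \<in> V" "i < m v" for v i
    using that unfolding incident_edges_def pendant_edges_def by auto
  have col_l: "color_set ?E \<beta> (Inl v) = color_set E \<alpha> v \<union> S v" if "v \<in> V" for v
    unfolding color_set_def inc_l[OF that] image_Un image_image inl inr h(1)[OF that] ..
  have col_r: "color_set ?E \<beta> (Inr (v, i)) = {h v i}" if "v \<in> V" "i < m v" for v i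
    unfolding color_set_def inc_r[OF that] by (simp add: inr)
  \<comment> \<open>Old edges are separated by \<open>\<alpha>\<close>, pendant edges by the
    bijection \<open>h v\<close>, and \<open>S v\<close> avoids the old colors at
    \<open>v\<close>.\<close>
  have inj: "inj_on \<beta> (incident_edges ?E (Inl v))" if v: "v \<in> V" for v
  proof -
    have E: "inj_on \<beta> ((\<lambda>e. Inl ` e) ` incident_edges E v)"
    proof (rule inj_onI, elim imageE)
      fix x y e f
      assume a: "\<beta> x = \<beta> y" "x = Inl ` e" "e \<in> incident_edges E v" "y = Inl ` f" "f \<in> incident_edges E v"
      then have "\<alpha> e = \<alpha> f" by (simp add: inl)
      then have "e = f" using a(3,5) edge_colD[OF \<alpha>, of e f v] unfolding incident_edges_def by simp
      then show "x = y" using a by simp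
    qed
    have P: "inj_on \<beta> ((\<lambda>i. {Inl v, Inr (v, i)}) ` {..<m v})"
      using inj_onD[OF h(2)[OF v]] by (auto simp: inj_on_def inr)
    have "\<beta> ` (\<lambda>e. Inl ` e) ` incident_edges E v = color_set E \<alpha> v"
      by (simp add: image_image inl color_set_def)
    moreover have "\<beta> ` (\<lambda>i. {Inl v, Inr (v, i)}) ` {..<m v} = S v"
      by (simp add: image_image inr h(1)[OF v])
    ultimately have "\<beta> ` (\<lambda>e. Inl ` e) ` incident_edges E v \<inter> \<beta> ` (\<lambda>i. {Inl v, Inr (v, i)}) ` {..<m v} = {}"
      using S(1)[OF v] by auto
    then show ?thesis unfolding inc_l[OF v] using E P by (auto simp: inj_on_Un)
  qed
  have "proper_edge_coloring ?E t \<beta>"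
    unfolding proper_edge_coloring_def
  proof (intro conjI ballI impI)
    show "\<beta> ` ?E \<subseteq> {1..t}"
    proof (rule image_subsetI)
      fix f assume f: "f \<in> ?E"
      show "\<beta> f \<in> {1..t}"
      proof (cases "f \<in> (\<lambda>e. Inl ` e) ` E")
        case True
        then obtain e where "e \<in> E" "f = Inl ` e" by blast
        then show ?thesis using edge_col_mem[OF \<alpha>] inl by simp
      next
        case False
        then obtain v i where v: "f = {Inl v, Inr (v, i)}" "v \<in> V" "i < m v" using pend[OF f] by blast
        then have "h v i \<in> {1..t}" using h_mem[of v i] S(1)[of v] by blast
        then show ?thesis using v inr by simp
      qed
    qed
    fix e f assume ef: "e \<in> ?E" "f \<in> ?E" "e \<noteq> f \<and> e \<inter> f \<noteq> {}"
    then obtain x where x: "x \<in> e" "x \<in> f" by blast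
    have "x \<in> ?V"
    proof (cases "e \<in> (\<lambda>e. Inl ` e) ` E")
      case True
      then obtain e' where "e' \<in> E" "e = Inl ` e'" by blast
      then show ?thesis using x(1) bspec[OF edges] unfolding pendant_verts_def by auto
    next
      case False
      then show ?thesis using pend[OF ef(1)] x(1) unfolding pendant_verts_def by auto
    qed
    then consider v where "v \<in> V" "x = Inl v" | v i where "v \<in> V" "i < m v" "x = Inr (v, i)"
      unfolding pendant_verts_def by auto
    then show "\<beta> e \<noteq> \<beta> f"
    proof cases
      case 1
      have "e \<in> incident_edges ?E x" "f \<in> incident_edges ?E x"
        using ef x unfolding incident_edges_def by simp_all
      then show ?thesis using inj_onD[OF inj[OF 1(1)], of e f] ef(3) 1(2) by auto
    next
      case 2
      have "e \<in> incident_edges ?E x" "f \<in> incident_edges ?E x"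
        using ef x unfolding incident_edges_def by simp_all
      then show ?thesis using inc_r[OF 2(1,2)] 2(3) ef(3) by simp
    qed
  qed
  moreover have "cyclic_interval t (color_set ?E \<beta> x)" if xV: "x \<in> ?V" for x
  proof -
    consider v where "v \<in> V" "x = Inl v" | v i where "v \<in> V" "i < m v" "x = Inr (v, i)"
      using xV unfolding pendant_verts_def by auto
    then show ?thesis
    proof cases
      case 1
      then show ?thesis using S(2) by (simp add: col_l)
    next
      case 2
      have "{h v i} \<subseteq> {1..t}" using h_mem[OF 2(1,2)] S(1)[OF 2(1)] by blast
      moreover have "integer_interval {h v i}"
        unfolding integer_interval_def by (intro exI[of _ "h v i"]) simp
      ultimately show ?thesis unfolding 2(3) col_r[OF 2(1,2)] cyclic_interval_def by blast
    qed
  qed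
  ultimately have "cyclically_interval_colorable ?V ?E"
    unfolding cyclically_interval_colorable_def cyclic_interval_coloring_def
    by (intro exI[of _ t] exI[of _ \<beta>] conjI ballI)
  then have "\<exists>m'. (\<Sum>v\<in>V. card (S v)) = (\<Sum>v\<in>V. m' v) \<and>
      cyclically_interval_colorable (pendant_verts V m') (pendant_edges V E m')"
    by (intro exI[of _ m]) (simp add: m_def)
  then show ?thesis unfolding cyclic_deficiency_def by (rule Least_le)
qed

text \<open>Adding every color outside \<open>X\<close> and \<open>Y\<close> leaves exactly the
  interval \<open>Y\<close> as complement, so a longer interval of missing colors means a lower
  cost.\<close>

lemma fill_colors:
  assumes "X \<subseteq> {1..t}" "integer_interval Y" "Y \<subseteq> {1..t} - X"
  shows "\<exists>S. S \<subseteq> {1..t} - X \<and> cyclic_interval t (X \<union> S) \<and> card S = t - card X - card Y"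
proof (intro exI conjI)
  let ?S = "{1..t} - X - Y"
  show "?S \<subseteq> {1..t} - X" by blast
  have "{1..t} - (X \<union> ?S) = Y" using assms by blast
  then show "cyclic_interval t (X \<union> ?S)" using assms unfolding cyclic_interval_def by auto
  have "finite X" "finite Y" using assms(1,3) by (meson finite_Diff finite_atLeastAtMost finite_subset)+
  then show "card ?S = t - card X - card Y"
    using assms by (simp add: card_Diff_subset)
qed

lemma (in bounded_degree_graph) cyclic_deficiency_bound:
  assumes deg_ge: "\<And>v. v \<in> V \<Longrightarrow> D \<le> degree E v + 2"
  shows "cyclic_deficiency V E \<le> card V"
proof -
  obtain \<alpha> where \<alpha>: "edge_col E {1..D + 1} \<alpha>"
    and hits: "card {c\<in>C. color_set E \<alpha> c \<inter> {D, D + 1} \<noteq> {}} \<le> card A" by (rule coloring_few_hits)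
  define H where "H = {c\<in>C. color_set E \<alpha> c \<inter> {D, D + 1} \<noteq> {}}"
  \<comment> \<open>One unit per vertex outside \<open>A\<close> and a second one per vertex of
    \<open>H\<close>; since \<open>H\<close> is at most as large as \<open>A\<close>, the total is
    at most \<open>card V\<close>.\<close>
  let ?f = "\<lambda>v. (if v \<in> A then 0 else 1) + (if v \<in> H then 1 else 0 :: nat)"
  have "\<exists>S. S \<subseteq> {1..D + 1} - color_set E \<alpha> v \<and>
      cyclic_interval (D + 1) (color_set E \<alpha> v \<union> S) \<and> card S \<le> ?f v" if v: "v \<in> V" for v
  proof -
    let ?X = "color_set E \<alpha> v"
    have X: "?X \<subseteq> {1..D + 1}" by (rule color_set_subset[OF \<alpha>])
    have cX: "card ?X = degree E v" by (rule card_color_set[OF \<alpha>])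
    have le: "degree E v \<le> D" using deg_le v by blast
    \<comment> \<open>\<open>Y\<close> is the pair \<open>D\<close>, \<open>D + 1\<close> at a
      vertex of \<open>C\<close> outside \<open>H\<close>. Elsewhere it is one free color, which
      exists because at most \<open>D\<close> of the \<open>D + 1\<close> colors are used.\<close>
    have "\<exists>Y. integer_interval Y \<and> Y \<subseteq> {1..D + 1} - ?X \<and> D + 1 - degree E v - card Y \<le> ?f v"
    proof (cases "v \<in> C \<and> v \<notin> H")
      case True
      then have "?X \<inter> {D, D + 1} = {}" unfolding H_def by simp
      moreover have "{D..D + 1} = {D, D + 1}" by auto
      moreover have "{D, D + 1} \<subseteq> {1..D + 1}" using D_pos by auto
      ultimately have "{D..D + 1} \<subseteq> {1..D + 1} - ?X" by blast
      moreover have "v \<notin> A" using True disjoint(2) by blast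
      moreover have "D + 1 - degree E v - card {D..D + 1} \<le> 1" using True unfolding C_def by auto
      ultimately show ?thesis using True unfolding integer_interval_def
        by (intro exI[of _ "{D..D + 1}"]) auto
    next
      case False
      have "\<not> {1..D + 1} \<subseteq> ?X"
      proof
        assume "{1..D + 1} \<subseteq> ?X"
        then have "?X = {1..D + 1}" using X by blast
        then show False using cX le by simp
      qed
      then obtain x where x: "x \<in> {1..D + 1}" "x \<notin> ?X" by blast
      have "integer_interval {x}"
        unfolding integer_interval_def by (intro exI[of _ x]) simp
      moreover have "D + 1 - degree E v - card {x} \<le> ?f v"
      proof -
        consider "degree E v = D" | "degree E v + 1 = D" | "degree E v + 2 = D"
          using le deg_ge[OF v] by linarith
        then show ?thesis
        proof cases
          case 3
          then have "v \<in> C" using v unfolding C_def by simp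
          then show ?thesis using 3 False disjoint(2) by auto
        qed (use v in \<open>auto simp: A_def\<close>)
      qed
      ultimately show ?thesis using x by blast
    qed
    then obtain Y where Y: "integer_interval Y" "Y \<subseteq> {1..D + 1} - ?X"
      "D + 1 - degree E v - card Y \<le> ?f v" by blast
    from fill_colors[OF X Y(1,2)] Y(3) cX show ?thesis by metis
  qed
  then have "\<exists>S. \<forall>v\<in>V. S v \<subseteq> {1..D + 1} - color_set E \<alpha> v \<and>
      cyclic_interval (D + 1) (color_set E \<alpha> v \<union> S v) \<and> card (S v) \<le> ?f v"
    by (intro bchoice ballI)
  then obtain S where S: "\<forall>v\<in>V. S v \<subseteq> {1..D + 1} - color_set E \<alpha> v \<and>
      cyclic_interval (D + 1) (color_set E \<alpha> v \<union> S v) \<and> card (S v) \<le> ?f v" ..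
  have AV: "A \<subseteq> V" "H \<subseteq> V" unfolding A_def H_def C_def by auto
  have "cyclic_deficiency V E \<le> (\<Sum>v\<in>V. card (S v))"
    using S by (intro cyclic_deficiency_le[OF finV edges \<alpha>]) auto
  also have "\<dots> \<le> (\<Sum>v\<in>V. ?f v)" using S by (intro sum_mono) blast
  also have "\<dots> = (\<Sum>v\<in>V. if v \<in> A then 0 else 1) + (\<Sum>v\<in>V. if v \<in> H then 1 else 0)"
    by (rule sum.distrib)
  also have "(\<Sum>v\<in>V. if v \<in> A then 0 else 1 :: nat) = card (V - A)"
    using finV by (simp add: sum.If_cases Diff_eq)
  also have "(\<Sum>v\<in>V. if v \<in> H then 1 else 0 :: nat) = card H"
    using finV AV by (simp add: sum.If_cases Int_absorb1)
  also have "card (V - A) + card H \<le> card (V - A) + card A" using hits unfolding H_def by simp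
  also have "\<dots> = card V"
    using card_Diff_subset[of A V] card_mono[OF finV AV(1)] finite_subset[OF AV(1) finV] AV(1) by simp
  finally show ?thesis .
qed

theorem theorem15:
  fixes V :: "'a set" and E :: "'a set set"
  assumes "simple_graph V E"
    and "max_degree V E - min_degree V E \<le> 2"
  shows "cyclic_deficiency V E \<le> card V"
proof -
  have fin: "finite V" and edges: "\<forall>e\<in>E. e \<subseteq> V \<and> card e = 2"
    using assms(1) unfolding simple_graph_def by auto
  have deg_le: "degree E v \<le> max_degree V E" and deg_ge: "min_degree V E \<le> degree E v"
    if "v \<in> V" for v
    using that fin unfolding max_degree_def min_degree_def by simp_all
  show ?thesis
  \<comment> \<open>Edgeless graphs, including the one without vertices, are split off because the
    locale demands \<open>0 < D\<close>; for them \<open>t = 0\<close> works without pendant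
    edges.\<close>
  proof (cases "E = {}")
    case True
    have "cyclic_interval 0 {}"
      unfolding cyclic_interval_def integer_interval_def by (auto intro: exI[of _ 1])
    then have "cyclic_deficiency V E \<le> (\<Sum>v\<in>V. card ({} :: nat set))"
      using True by (intro cyclic_deficiency_le[OF fin edges, of 0 "\<lambda>_. 0"])
        (simp_all add: edge_col_def color_set_def incident_edges_def)
    then show ?thesis by simp
  next
    case False
    then obtain e where e: "e \<in> E" by blast
    then have "e \<noteq> {}" "e \<subseteq> V" using bspec[OF edges e] by auto
    then obtain v where v: "v \<in> e" "v \<in> V" by blast
    have "1 \<le> degree E v" using degree_pos_iff[OF finite_edges[OF fin edges]] e v by blast
    then have "0 < max_degree V E" using deg_le[OF v(2)] by simp
    then interpret bounded_degree_graph V E "max_degree V E"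
      using fin edges deg_le by unfold_locales auto
    have "max_degree V E \<le> degree E v + 2" if "v \<in> V" for v
      using deg_ge[OF that] assms(2) by linarith
    then show ?thesis by (rule cyclic_deficiency_bound)
  qed
qed

end
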